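(* Let $P$, $X$, $Y$ be metric spaces, let $C\subset Y$ be a nonempty closed proper subset, and let $F:P\times X\rightrightarrows Y$ be a set-valued mapping with nonempty closed values at every point of $P\times X$. Let $S(p)=\{x\in X: F(p,x)\subseteq C\}$ for $p\in P$ and $\varphi_F(p,x)=\sup_{y\in F(p,x)}\mathrm{dist}(y,C)$. Let $\bar p\in P$ with $S(\bar p)\neq\varnothing$. Suppose that: (i) $(X,d)$ is metrically complete; (ii) the set-valued mapping $F(\bar p,\cdot):X\rightrightarrows Y$ is lower semicontinuous on $X$; (iii) the mapping $F$ is locally Lipschitz near $\bar p$ with respect to $p$, uniformly in $x\in X$; (iv) $\tau_{\bar p}>0$. Then the solution mapping $S:P\rightrightarrows X$ is Lipschitz upper semicontinuous at $\bar p$ and $$\mathrm{Lipusc}\,S(\bar p)\le\frac{\mathrm{Lip_p}\,F(\bar p,X)}{\tau_{\bar p}}.$$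
   Context: All metrics are denoted $d$. $B(x,r)$ is the closed ball of center $x$ and radius $r$; $\mathrm{dist}(x,A)=\inf_{a\in A}d(x,a)$ ($=+\infty$ if $A=\varnothing$); $B(A,r)=\{x:\mathrm{dist}(x,A)\le r\}$. For subsets $A,B$ of a metric space, $\mathrm{exc}(A,B)=\sup_{a\in A}\mathrm{dist}(a,B)$ and $\mathrm{haus}(A,B)=\max\{\mathrm{exc}(A,B),\mathrm{exc}(B,A)\}$. A set-valued mapping $\Phi:X\rightrightarrows Y$ between metric spaces is: - lower semicontinuous (l.s.c.) at $\bar x$ if for every open $O\subseteq Y$ with $\Phi(\bar x)\cap O\neq\varnothing$ there is a neighbourhood $U$ of $\bar x$ with $\Phi(x)\cap O\ne\varnothing$ for all $x\in U$; - Lipschitz upper semicontinuous at $\bar x$ if there are $\delta,\ell>0$ such that $\Phi(x)\subseteq B(\Phi(\bar x),\ell d(x,\bar x))$ for all $x\in B(\bar x,\delta)$; $\mathrm{Lipusc}\,\Phi(\bar x)$ is the infimum of all $\ell>0$ for which such a $\delta>0$ exists. $F$ is locally Lipschitz near $\bar p$ with respect to $p$, uniformly in $x\in X$, if there are $\ell,\delta>0$ such that $\sup_{x\in X}\mathrm{haus}(F(p_1,x),F(p_2,x))\le\ell d(p_1,p_2)$ for all $p_1,p_2\in B(\bar p,\delta)$; $\mathrm{Lip_p}\,F(\bar p,X)$ is the infimum of all $\ell>0$ for which such a $\delta>0$ exists. The strong slope of $\psi:X\to\mathbb R\cup\{\pm\infty\}$ at a point $x$ with $\psi(x)\in\mathbb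 R$ is $|\nabla\psi|(x)=0$ if $x$ is a local minimizer of $\psi$, and $|\nabla\psi|(x)=\limsup_{z\to x}\frac{\psi(x)-\psi(z)}{d(z,x)}$ otherwise. Set $$\tau_{\bar p}=\inf\{|\nabla\varphi_F(\bar p,\cdot)|(x): x\in X\setminus S(\bar p)\},$$ the infimum being over those $x$ at which the slope is defined, i.e. $\varphi_F(\bar p,x)<+\infty$, with $\inf\varnothing=+\infty$; a finite number divided by $+\infty$ is $0$. *)

theory Defs
  imports "HOL-Analysis.Analysis"
begin

text \<open>Distances are extended-real valued, so that the distance to the empty set is
  \<open>\<infinity>\<close>; the library's \<^const>\<open>infdist\<close> gives \<open>0\<close> there.\<close>

definition edist_set :: "'a::metric_space \<Rightarrow> 'a set \<Rightarrow> ereal" where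
  "edist_set x A = (INF a\<in>A. ereal (dist x a))"

definition enlargement :: "'a::metric_space set \<Rightarrow> real \<Rightarrow> 'a set" where
  "enlargement A r = {x. edist_set x A \<le> ereal r}"

text \<open>The supremum is taken in \<^typ>\<open>ereal\<close>, so the excess of the empty set is
  \<open>-\<infinity>\<close>; below, the excess is only applied to nonempty sets.\<close>

definition excess :: "'a::metric_space set \<Rightarrow> 'a set \<Rightarrow> ereal" where
  "excess A B = (SUP a\<in>A. edist_set a B)"

definition haus :: "'a::metric_space set \<Rightarrow> 'a set \<Rightarrow> ereal" where
  "haus A B = max (excess A B) (excess B A)"

definition lsc_at :: "('a::metric_space \<Rightarrow> 'b::metric_space set) \<Rightarrow> 'a \<Rightarrow> bool" where
  "lsc_at \<Phi> x0 \<longleftrightarrow>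
     (\<forall>V. open V \<and> \<Phi> x0 \<inter> V \<noteq> {} \<longrightarrow>
        (\<exists>U. open U \<and> x0 \<in> U \<and> (\<forall>x\<in>U. \<Phi> x \<inter> V \<noteq> {})))"

definition lipschitz_usc_const ::
  "('a::metric_space \<Rightarrow> 'b::metric_space set) \<Rightarrow> 'a \<Rightarrow> real \<Rightarrow> bool" where
  "lipschitz_usc_const \<Phi> x0 l \<longleftrightarrow>
     (\<exists>\<delta>>0. \<forall>x\<in>cball x0 \<delta>. \<Phi> x \<subseteq> enlargement (\<Phi> x0) (l * dist x x0))"

definition lipschitz_usc_at ::
  "('a::metric_space \<Rightarrow> 'b::metric_space set) \<Rightarrow> 'a \<Rightarrow> bool" where
  "lipschitz_usc_at \<Phi> x0 \<longleftrightarrow> (\<exists>l>0. lipschitz_usc_const \<Phi> x0 l)"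

definition Lipusc :: "('a::metric_space \<Rightarrow> 'b::metric_space set) \<Rightarrow> 'a \<Rightarrow> ereal" where
  "Lipusc \<Phi> x0 = Inf {ereal l | l. l > 0 \<and> lipschitz_usc_const \<Phi> x0 l}"

definition param_lipschitz_const ::
  "('p::metric_space \<Rightarrow> 'x \<Rightarrow> 'y::metric_space set) \<Rightarrow> 'p \<Rightarrow> real \<Rightarrow> bool" where
  "param_lipschitz_const F p0 l \<longleftrightarrow>
     (\<exists>\<delta>>0. \<forall>p1\<in>cball p0 \<delta>. \<forall>p2\<in>cball p0 \<delta>.
        (SUP x. haus (F p1 x) (F p2 x)) \<le> ereal (l * dist p1 p2))"

definition locally_param_lipschitz ::
  "('p::metric_space \<Rightarrow> 'x \<Rightarrow> 'y::metric_space set) \<Rightarrow> 'p \<Rightarrow> bool" where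
  "locally_param_lipschitz F p0 \<longleftrightarrow> (\<exists>l>0. param_lipschitz_const F p0 l)"

definition Lip_p :: "('p::metric_space \<Rightarrow> 'x \<Rightarrow> 'y::metric_space set) \<Rightarrow> 'p \<Rightarrow> ereal" where
  "Lip_p F p0 = Inf {ereal l | l. l > 0 \<and> param_lipschitz_const F p0 l}"

definition local_minimizer :: "('a::metric_space \<Rightarrow> ereal) \<Rightarrow> 'a \<Rightarrow> bool" where
  "local_minimizer \<psi> x \<longleftrightarrow> (\<exists>\<epsilon>>0. \<forall>z\<in>ball x \<epsilon>. \<psi> x \<le> \<psi> z)"

text \<open>Meaningful only where \<open>\<psi> x\<close> is finite. The upper limit is over \<open>z \<noteq> x\<close>; an isolated
  point is a local minimizer, so the trivial filter never occurs in the second branch.\<close>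

definition strong_slope :: "('a::metric_space \<Rightarrow> ereal) \<Rightarrow> 'a \<Rightarrow> ereal" where
  "strong_slope \<psi> x =
     (if local_minimizer \<psi> x then 0
      else Limsup (at x) (\<lambda>z. (\<psi> x - \<psi> z) / ereal (dist z x)))"

definition solution_map :: "('p \<Rightarrow> 'x \<Rightarrow> 'y set) \<Rightarrow> 'y set \<Rightarrow> 'p \<Rightarrow> 'x set" where
  "solution_map F C p = {x. F p x \<subseteq> C}"

definition merit :: "('p \<Rightarrow> 'x \<Rightarrow> 'y::metric_space set) \<Rightarrow> 'y set \<Rightarrow> 'p \<Rightarrow> 'x \<Rightarrow> ereal" where
  "merit F C p x = (SUP y\<in>F p x. edist_set y C)"

text \<open>The merit function is nonnegative when \<open>F\<close> has nonempty values, so being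
  below \<open>\<infinity>\<close> is the same as being finite.\<close>

definition slope_inf ::
  "('p \<Rightarrow> 'x::metric_space \<Rightarrow> 'y::metric_space set) \<Rightarrow> 'y set \<Rightarrow> 'p \<Rightarrow> ereal" where
  "slope_inf F C p =
     (INF x\<in>{x. x \<notin> solution_map F C p \<and> merit F C p x < \<infinity>}. strong_slope (merit F C p) x)"

end

theory Submission
  imports Defs
begin

text \<open>For \<open>x \<in> S(p)\<close> the Lipschitz dependence of \<open>F\<close> on the parameter bounds the merit
  \<open>\<phi>(p0, x)\<close> by \<open>l * d(p, p0)\<close>. Ekeland's variational principle, applied to \<open>\<phi>(p0, \<cdot>)\<close> from \<open>x\<close>
  with a constant \<open>c < \<tau>\<close>, gives a point \<open>z\<close> with \<open>c * d(x, z) \<le> \<phi>(p0, x)\<close> at which the strong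
  slope is at most \<open>c\<close>. Such a \<open>z\<close> must lie in \<open>S(p0)\<close>, so \<open>l / c\<close> is an upper Lipschitz constant
  of \<open>S\<close>; it remains to optimise over \<open>l\<close> and \<open>c\<close>.\<close>

section \<open>Ekeland's principle and the error bound it gives\<close>

text \<open>Starting at \<open>x0\<close>, each new point nearly minimises \<open>g\<close> over the
  points below the current one in Ekeland's order. The iterates converge, and the limit has nothing
  strictly below it. Completeness of the sublevel sets serves twice: it yields the limit, and, as
  complete sets are closed, it yields lower semicontinuity along the sequence.\<close>

lemma ekeland_variational_principle:
  fixes g :: "'a::metric_space \<Rightarrow> real"
  assumes compl: "\<And>a. complete {x \<in> D. g x \<le> a}"
    and below: "\<And>x. x \<in> D \<Longrightarrow> b \<le> g x"
    and x0: "x0 \<in> D" and c: "c > 0"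
  obtains z where "z \<in> D" "g z + c * dist x0 z \<le> g x0"
    "\<And>w. w \<in> D \<Longrightarrow> w \<noteq> z \<Longrightarrow> g z < g w + c * dist z w"
proof -
  \<comment> \<open>\<open>T x\<close> is the set of points below \<open>x\<close> in Ekeland's
    order; \<open>T_trans\<close> is the transitivity of that order.\<close>
  define T where "T x = {w \<in> D. g w + c * dist x w \<le> g x}" for x
  have T_trans: "w \<in> T x" if "y \<in> T x" "w \<in> T y" for x y w
  proof -
    have "c * dist x w \<le> c * (dist x y + dist y w)"
      using c dist_triangle by simp
    then show ?thesis
      using that by (auto simp: T_def algebra_simps)
  qed
  have near_min: "\<exists>y. y \<in> T x \<and> (\<forall>w \<in> T x. g y \<le> g w + e)" if "x \<in> D" "e > 0" for x e
  proof -
    have "x \<in> T x" using that by (simp add: T_def)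
    then have ne: "g ` T x \<noteq> {}" by blast
    have bdd: "bdd_below (g ` T x)"
      using below by (intro bdd_belowI[of _ b]) (auto simp: T_def)
    have "Inf (g ` T x) < Inf (g ` T x) + e" using that by simp
    from cInf_lessD[OF ne this] obtain y where y: "y \<in> T x" "g y < Inf (g ` T x) + e"
      by blast
    have "Inf (g ` T x) \<le> g w" if "w \<in> T x" for w
      using bdd that by (simp add: cInf_lower)
    then show ?thesis using y by fastforce
  qed
  \<comment> \<open>Dependent choice carries the invariant \<open>u n \<in> D\<close>; the clause
    for \<open>n = 0\<close> pins the starting point. The tolerance tends to 0, which the minimality
    of the limit relies on.\<close>
  have "\<exists>u. \<forall>n. (u n \<in> D \<and> (n = 0 \<longrightarrow> u n = x0)) \<and>
      (u (Suc n) \<in> T (u n) \<and> (\<forall>w \<in> T (u n). g (u (Suc n)) \<le> g w + inverse (real (Suc n))))"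
  proof (rule dependent_nat_choice)
    show "\<exists>x. x \<in> D \<and> ((0::nat) = 0 \<longrightarrow> x = x0)" using x0 by blast
  next
    fix x and n :: nat
    assume "x \<in> D \<and> (n = 0 \<longrightarrow> x = x0)"
    then obtain y where "y \<in> T x" "\<forall>w \<in> T x. g y \<le> g w + inverse (real (Suc n))"
      using near_min[of x "inverse (real (Suc n))"] by auto
    then show "\<exists>y. (y \<in> D \<and> (Suc n = 0 \<longrightarrow> y = x0)) \<and>
        (y \<in> T x \<and> (\<forall>w \<in> T x. g y \<le> g w + inverse (real (Suc n))))"
      by (auto simp: T_def)
  qed
  then obtain u where uD: "\<And>n. u n \<in> D" and u0: "u 0 = x0"
    and uT: "\<And>n. u (Suc n) \<in> T (u n)"
    and umin: "\<And>n w. w \<in> T (u n) \<Longrightarrow> g (u (Suc n)) \<le> g w + inverse (real (Suc n))"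
    by metis
  have chain: "u m \<in> T (u n)" if "n \<le> m" for n m
    using that
  proof (induction rule: dec_induct)
    case base
    show ?case using uD by (simp add: T_def)
  next
    case (step m)
    show ?case using T_trans[OF step.IH uT] .
  qed
  then have gap: "c * dist (u n) (u m) \<le> g (u n) - g (u m)" if "n \<le> m" for n m
    using that by (force simp: T_def)
  have dec: "decseq (g \<circ> u)"
    unfolding decseq_def comp_def
  proof (intro allI impI)
    fix n m :: nat
    assume "n \<le> m"
    from gap[OF this] show "g (u m) \<le> g (u n)"
      using c zero_le_dist[of "u n" "u m"] by (smt (verit) mult_nonneg_nonneg)
  qed
  then obtain L where L: "(g \<circ> u) \<longlonglongrightarrow> L" "\<And>n. L \<le> (g \<circ> u) n"
    by (rule decseq_convergent[where B = b]) (use below uD in auto)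
  \<comment> \<open>By \<open>gap\<close>, distances are controlled by differences of the convergent
    sequence \<open>g (u n)\<close>.\<close>
  have "Cauchy u"
  proof (rule metric_CauchyI)
    fix e :: real
    assume e: "e > 0"
    then have "eventually (\<lambda>n. g (u n) < L + c * e) sequentially"
      using c by (intro order_tendstoD(2)[OF L(1)[unfolded comp_def]]) simp
    then obtain N where N: "\<And>n. n \<ge> N \<Longrightarrow> g (u n) < L + c * e"
      by (auto simp: eventually_sequentially)
    have close: "dist (u n) (u m) < e" if "N \<le> n" "n \<le> m" for n m
    proof -
      have "c * dist (u n) (u m) < c * e"
        using gap[OF that(2)] N[OF that(1)] L(2)[of m] by simp
      then show ?thesis using c by simp
    qed
    show "\<exists>M. \<forall>m\<ge>M. \<forall>n\<ge>M. dist (u m) (u n) < e"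
      using close by (metis dist_commute linear)
  qed
  moreover have "\<forall>n. u n \<in> {x \<in> D. g x \<le> g x0}"
    using uD decseqD[OF dec, of 0] by (auto simp: u0)
  ultimately obtain z where z: "z \<in> D" "u \<longlonglongrightarrow> z"
    using compl[of "g x0"] unfolding complete_def by blast
  \<comment> \<open>The sequence ends up in the closed sublevel set at \<open>L + e\<close>, hence
    so does its limit.\<close>
  have gz: "g z \<le> L"
  proof (rule field_le_epsilon)
    fix e :: real
    assume "e > 0"
    then have "eventually (\<lambda>n. g (u n) < L + e) sequentially"
      by (intro order_tendstoD(2)[OF L(1)[unfolded comp_def]]) simp
    then have "eventually (\<lambda>n. u n \<in> {x \<in> D. g x \<le> L + e}) sequentially"
      using uD by (auto elim!: eventually_mono)
    then have "z \<in> {x \<in> D. g x \<le> L + e}"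
      using z(2) by (intro Lim_in_closed_set[OF complete_imp_closed[OF compl]]) auto
    then show "g z \<le> L + e" by simp
  qed
  have zT: "z \<in> T (u n)" for n
  proof -
    have "c * dist (u n) z \<le> g (u n) - L"
    proof (rule LIMSEQ_le)
      show "(\<lambda>m. c * dist (u n) (u m)) \<longlonglongrightarrow> c * dist (u n) z"
        using z(2) by (intro tendsto_intros)
      show "(\<lambda>m. g (u n) - g (u m)) \<longlonglongrightarrow> g (u n) - L"
        using L(1) by (intro tendsto_intros) (simp add: comp_def)
      show "\<exists>N. \<forall>m\<ge>N. c * dist (u n) (u m) \<le> g (u n) - g (u m)"
        using gap by blast
    qed
    then show ?thesis using z(1) gz by (simp add: T_def)
  qed
  show ?thesis
  proof
    show "z \<in> D" by fact
    show "g z + c * dist x0 z \<le> g x0"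
      using zT[of 0] by (simp add: T_def u0)
    fix w
    assume w: "w \<in> D" "w \<noteq> z"
    show "g z < g w + c * dist z w"
    proof (rule ccontr)
      assume "\<not> ?thesis"
      \<comment> \<open>By transitivity \<open>w\<close> lies in every \<open>T (u n)\<close>, so
        near-minimality gives \<open>g z \<le> g w\<close> in the limit, whereas
        \<open>w \<in> T z\<close> with \<open>w \<noteq> z\<close> forces
        \<open>g w < g z\<close>.\<close>
      then have wz: "w \<in> T z" using w by (simp add: T_def)
      have "g z \<le> g w + inverse (real (Suc n))" for n
        using umin[OF T_trans[OF zT wz], of n] gz L(2)[of "Suc n"] by simp
      moreover have "(\<lambda>n. g w + inverse (real (Suc n))) \<longlonglongrightarrow> g w + 0"
        by (intro tendsto_intros LIMSEQ_inverse_real_of_nat)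
      ultimately have "g z \<le> g w"
        by (auto intro: LIMSEQ_le_const[where a = "g z"])
      moreover have "c * dist z w > 0" using c w by simp
      ultimately show False using wz by (simp add: T_def)
    qed
  qed
qed

text \<open>Ekeland's principle, applied to the real-valued \<open>g\<close> on the domain
  \<open>D\<close> where \<open>\<psi>\<close> is finite, produces a point whose slope is at most
  \<open>c\<close>; by the slope assumption \<open>\<psi>\<close> cannot be positive there.\<close>

lemma slope_error_bound:
  fixes \<psi> :: "'a::metric_space \<Rightarrow> ereal"
  assumes compl: "\<And>a. complete {x. \<psi> x \<le> ereal a}"
    and nonneg: "\<And>x. 0 \<le> \<psi> x"
    and slope: "\<And>x. 0 < \<psi> x \<Longrightarrow> \<psi> x < \<infinity> \<Longrightarrow> ereal c < strong_slope \<psi> x"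
    and c: "c > 0" and x: "\<psi> x \<le> ereal r"
  obtains z where "\<psi> z = 0" "c * dist x z \<le> r"
proof -
  define D where "D = {y. \<psi> y < \<infinity>}"
  define g where "g y = real_of_ereal (\<psi> y)" for y
  have g: "\<psi> y = ereal (g y)" if "y \<in> D" for y
    using that nonneg[of y] by (cases "\<psi> y") (auto simp: D_def g_def)
  have g_nonneg: "0 \<le> g y" for y
    using nonneg by (simp add: g_def real_of_ereal_pos)
  have sublevel: "{y \<in> D. g y \<le> a} = {y. \<psi> y \<le> ereal a}" for a
  proof -
    have "y \<in> D" if "\<psi> y \<le> ereal a" for y using that by (auto simp: D_def)
    then show ?thesis using g by fastforce
  qed
  have xD: "x \<in> D" using x by (auto simp: D_def)
  obtain z where z: "z \<in> D" "g z + c * dist x z \<le> g x"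
    and zmin: "\<And>w. w \<in> D \<Longrightarrow> w \<noteq> z \<Longrightarrow> g z < g w + c * dist z w"
    by (rule ekeland_variational_principle[of D g 0 x c, unfolded sublevel, OF compl g_nonneg xD c])
      (rule that)
  have quot: "(\<psi> z - \<psi> w) / ereal (dist w z) \<le> ereal c" if "w \<noteq> z" for w
  proof (cases "w \<in> D")
    case True
    then show ?thesis
      using zmin[OF True that] that
      by (simp add: g[OF True] g[OF z(1)] dist_commute divide_simps)
  next
    case False
    \<comment> \<open>Here \<open>\<psi> w = \<infinity>\<close>, so the quotient is
      \<open>-\<infinity>\<close>.\<close>
    then show ?thesis using that by (simp add: D_def g[OF z(1)])
  qed
  have "strong_slope \<psi> z \<le> ereal c"
  proof -
    have "Limsup (at z) (\<lambda>w. (\<psi> z - \<psi> w) / ereal (dist w z)) \<le> ereal c"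
      by (rule Limsup_bounded) (auto simp: eventually_at_filter quot)
    then show ?thesis using c by (simp add: strong_slope_def)
  qed
  then have "\<psi> z = 0"
    using slope[of z] nonneg[of z] z(1) by (force simp: D_def)
  moreover have "c * dist x z \<le> r"
    using z(2) x g[OF xD] g_nonneg[of z] by simp
  ultimately show ?thesis by (rule that)
qed

section \<open>Distances and the merit function\<close>

lemma edist_set_eq_infdist:
  assumes "A \<noteq> {}"
  shows "edist_set x A = ereal (infdist x A)"
proof -
  have "\<bar>INF a\<in>A. ereal (dist x a)\<bar> \<noteq> \<infinity>"
  proof -
    obtain a where "a \<in> A" using assms by blast
    then have "(INF a\<in>A. ereal (dist x a)) \<le> ereal (dist x a)" by (rule INF_lower)
    moreover have "0 \<le> (INF a\<in>A. ereal (dist x a))" by (rule INF_greatest) simp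
    ultimately show ?thesis by auto
  qed
  then show ?thesis
    using assms by (simp add: edist_set_def infdist_def ereal_Inf' ereal_INF image_image)
qed

lemma edist_set_antimono: "A \<subseteq> B \<Longrightarrow> edist_set x B \<le> edist_set x A"
  unfolding edist_set_def by (rule INF_superset_mono) auto

lemma merit_nonneg:
  assumes "F p x \<noteq> {}"
  shows "0 \<le> merit F C p x"
proof -
  obtain y where y: "y \<in> F p x" using assms by blast
  have "0 \<le> edist_set y C" unfolding edist_set_def by (rule INF_greatest) simp
  also have "\<dots> \<le> merit F C p x" unfolding merit_def using y by (rule SUP_upper)
  finally show ?thesis .
qed

text \<open>A supremum is at most 0 iff each term is, and closedness of \<open>C\<close> turns
  distance 0 into membership.\<close>

lemma merit_le_0_iff:
  assumes "closed C" "C \<noteq> {}"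
  shows "merit F C p x \<le> 0 \<longleftrightarrow> x \<in> solution_map F C p"
proof -
  have "infdist y C \<le> 0 \<longleftrightarrow> y \<in> C" for y
    using in_closed_iff_infdist_zero[OF assms] infdist_nonneg[of y C] by force
  then show ?thesis
    using assms(2)
    by (auto simp: merit_def edist_set_eq_infdist SUP_le_iff solution_map_def)
qed

text \<open>The merit exceeds \<open>a\<close> at \<open>x\<close> exactly when \<open>F p x\<close>
  meets the open set \<open>V\<close> of points farther than \<open>a\<close> from \<open>C\<close>;
  lower semicontinuity makes this an open condition on \<open>x\<close>.\<close>

lemma closed_merit_sublevel:
  assumes "C \<noteq> {}" and lsc: "\<And>x. lsc_at (F p) x"
  shows "closed {x. merit F C p x \<le> ereal a}"
proof -
  define V where "V = {y. a < infdist y C}"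
  have V: "open V"
    unfolding V_def by (intro open_Collect_less continuous_intros)
  have gt: "ereal a < merit F C p x \<longleftrightarrow> F p x \<inter> V \<noteq> {}" for x
    using assms(1) by (auto simp: V_def merit_def edist_set_eq_infdist less_SUP_iff)
  have "open {x. F p x \<inter> V \<noteq> {}}"
  proof (rule Topological_Spaces.openI)
    fix x
    assume "x \<in> {x. F p x \<inter> V \<noteq> {}}"
    then have "open V \<and> F p x \<inter> V \<noteq> {}" using V by simp
    then obtain U where "open U" "x \<in> U" "\<forall>z\<in>U. F p z \<inter> V \<noteq> {}"
      using lsc[of x] unfolding lsc_at_def by metis
    then show "\<exists>U. open U \<and> x \<in> U \<and> U \<subseteq> {x. F p x \<inter> V \<noteq> {}}"
      by (intro exI[of _ U]) auto
  qed
  moreover have "- {x. merit F C p x \<le> ereal a} = {x. F p x \<inter> V \<noteq> {}}"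
    by (auto simp: not_le simp flip: gt)
  ultimately show ?thesis
    by (simp add: closed_def)
qed

text \<open>Since \<open>F p x\<close> lies in \<open>C\<close>, the distance to \<open>C\<close> is
  at most the distance to \<open>F p x\<close>.\<close>

lemma merit_le_excess:
  assumes "x \<in> solution_map F C p"
  shows "merit F C q x \<le> excess (F q x) (F p x)"
  using assms unfolding merit_def excess_def solution_map_def
  by (intro SUP_mono) (auto intro: edist_set_antimono)

section \<open>Lipschitz bounds for the solution mapping\<close>

text \<open>The radius of the Lipschitz condition on \<open>F\<close> is kept unchanged, because the
  slope bound holds on the whole space.\<close>

lemma lipschitz_usc_const_solution_map:
  fixes F :: "'p::metric_space \<Rightarrow> 'x::metric_space \<Rightarrow> 'y::metric_space set"
  assumes C: "closed C" "C \<noteq> {}"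
    and ne: "\<And>x. F p0 x \<noteq> {}"
    and compl: "complete (UNIV :: 'x set)"
    and lsc: "\<And>x. lsc_at (F p0) x"
    and l: "param_lipschitz_const F p0 l"
    and c: "c > 0" "ereal c < slope_inf F C p0"
  shows "lipschitz_usc_const (solution_map F C) p0 (l / c)"
proof -
  obtain \<delta> where \<delta>: "\<delta> > 0"
    and lip: "\<And>p1 p2. p1 \<in> cball p0 \<delta> \<Longrightarrow> p2 \<in> cball p0 \<delta> \<Longrightarrow>
      (SUP x. haus (F p1 x) (F p2 x)) \<le> ereal (l * dist p1 p2)"
    using l unfolding param_lipschitz_const_def by metis
  have "x \<in> enlargement (solution_map F C p0) (l / c * dist p p0)"
    if p: "p \<in> cball p0 \<delta>" and x: "x \<in> solution_map F C p" for p x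
  proof -
    have "merit F C p0 x \<le> excess (F p0 x) (F p x)" by (rule merit_le_excess[OF x])
    also have "\<dots> \<le> haus (F p x) (F p0 x)" by (simp add: haus_def)
    also have "\<dots> \<le> (SUP x. haus (F p x) (F p0 x))" by (rule SUP_upper) simp
    also have "\<dots> \<le> ereal (l * dist p p0)" using p \<delta> by (intro lip) auto
    finally have bound: "merit F C p0 x \<le> ereal (l * dist p p0)" .
    obtain z where z: "merit F C p0 z = 0" "c * dist x z \<le> l * dist p p0"
    proof (rule slope_error_bound[where \<psi> = "merit F C p0", OF _ _ _ c(1) bound])
      show "complete {x. merit F C p0 x \<le> ereal a}" for a
        using complete_Int_closed[OF compl closed_merit_sublevel[of C F p0 a]] C(2) lsc
        by simp
      show "0 \<le> merit F C p0 x" for x by (rule merit_nonneg[of F p0 x C, OF ne])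
      show "ereal c < strong_slope (merit F C p0) y"
        if y: "0 < merit F C p0 y" "merit F C p0 y < \<infinity>" for y
      proof -
        have "y \<notin> solution_map F C p0"
          using y(1) by (simp flip: merit_le_0_iff[OF C])
        then have "slope_inf F C p0 \<le> strong_slope (merit F C p0) y"
          unfolding slope_inf_def using y(2) by (intro INF_lower) simp
        then show ?thesis using c(2) by (rule less_le_trans[rotated])
      qed
    qed
    have "z \<in> solution_map F C p0"
      using z(1) by (simp flip: merit_le_0_iff[OF C])
    then have "edist_set x (solution_map F C p0) \<le> ereal (dist x z)"
      unfolding edist_set_def by (rule INF_lower)
    also have "\<dots> \<le> ereal (l / c * dist p p0)"
      using z(2) c(1) by (simp add: field_simps)
    finally show ?thesis by (simp add: enlargement_def)
  qed
  then show ?thesis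
    using \<delta> unfolding lipschitz_usc_const_def by blast
qed

text \<open>Lets \<open>c\<close> increase to \<open>t\<close>. The value
  \<open>t = \<infinity>\<close> is allowed; then \<open>m / t = 0\<close> and the claim is
  \<open>u \<le> 0\<close>.\<close>

lemma ereal_le_divide_of_less:
  fixes u m t :: ereal
  assumes "0 \<le> u" "\<bar>m\<bar> \<noteq> \<infinity>" "0 < t"
    and bound: "\<And>c. 0 < c \<Longrightarrow> ereal c < t \<Longrightarrow> u \<le> m / ereal c"
  shows "u \<le> m / t"
proof -
  obtain m' where m: "m = ereal m'" using assms(2) by (cases m) auto
  obtain c0 where c0: "0 < c0" "ereal c0 < t"
    using ereal_dense2[OF assms(3)] by auto
  \<comment> \<open>A single admissible \<open>c0\<close> already makes \<open>u\<close>
    finite.\<close>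
  have "u \<le> ereal (m' / c0)"
    using bound[OF c0] c0(1) by (simp add: m)
  then obtain u' where u: "u = ereal u'" using assms(1) by (cases u) auto
  have mul: "u' * c \<le> m'" if "0 < c" "ereal c < t" for c
    using bound[OF that] that(1) by (simp add: m u pos_le_divide_eq)
  show ?thesis
  proof (cases t)
    case (real t')
    then have t': "0 < t'" using assms(3) by simp
    have "u' \<le> m' / t'"
    proof (rule ccontr)
      assume "\<not> ?thesis"
      then have "m' < u' * t'" using t' by (simp add: field_simps)
      moreover have "u' * t' \<le> m'"
      proof (rule tendsto_upperbound)
        show "((\<lambda>c. u' * c) \<longlongrightarrow> u' * t') (at_left t')" by (intro tendsto_intros)
        show "eventually (\<lambda>c. u' * c \<le> m') (at_left t')"
          using eventually_at_left_real[OF t'] by eventually_elim (simp add: mul real)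
      qed simp
      ultimately show False by simp
    qed
    then show ?thesis using t' by (simp add: m u real)
  next
    case PInf
    have "u' \<le> 0"
    proof (rule ccontr)
      assume "\<not> ?thesis"
      \<comment> \<open>Every positive \<open>c\<close> is admissible here; this one makes
        \<open>u' * c\<close> equal to \<open>\<bar>m'\<bar> + u'\<close>, which exceeds
        \<open>m'\<close>.\<close>
      moreover have "u' * (\<bar>m'\<bar> / u' + 1) \<le> m'"
        using \<open>\<not> u' \<le> 0\<close> by (intro mul) (auto simp: PInf intro: add_nonneg_pos)
      moreover have "u' * (\<bar>m'\<bar> / u' + 1) = \<bar>m'\<bar> + u'"
        using \<open>\<not> u' \<le> 0\<close> by (simp add: distrib_left)
      ultimately show False by linarith
    qed
    then show ?thesis by (simp add: m u PInf)
  next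
    case MInf
    then show ?thesis using assms(3) by simp
  qed
qed

theorem theorem3p5:
  fixes F :: "'p::metric_space \<Rightarrow> 'x::metric_space \<Rightarrow> 'y::metric_space set"
    and C :: "'y set"
    and p0 :: 'p
  assumes "closed C" and "C \<noteq> {}" and "C \<noteq> UNIV"
    and "\<And>p x. F p x \<noteq> {}" and "\<And>p x. closed (F p x)"
    and "solution_map F C p0 \<noteq> {}"
    and "complete (UNIV :: 'x set)"
    and "\<And>x. lsc_at (F p0) x"
    and "locally_param_lipschitz F p0"
    and "slope_inf F C p0 > 0"
  shows "lipschitz_usc_at (solution_map F C) p0
    \<and> Lipusc (solution_map F C) p0 \<le> Lip_p F p0 / slope_inf F C p0"
proof
  let ?S = "solution_map F C" and ?t = "slope_inf F C p0"
  have const: "lipschitz_usc_const ?S p0 (l / c)"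
    if "param_lipschitz_const F p0 l" "0 < c" "ereal c < ?t" for l c
    using assms that by (intro lipschitz_usc_const_solution_map) auto
  obtain l0 where l0: "l0 > 0" "param_lipschitz_const F p0 l0"
    using assms(9) unfolding locally_param_lipschitz_def by blast
  obtain c0 where c0: "0 < c0" "ereal c0 < ?t"
    using ereal_dense2[OF assms(10)] by auto
  show "lipschitz_usc_at ?S p0"
    unfolding lipschitz_usc_at_def using const[OF l0(2) c0] l0(1) c0(1) divide_pos_pos by blast
  have Lip_nonneg: "0 \<le> Lip_p F p0"
    unfolding Lip_p_def by (rule Inf_greatest) auto
  have Lip_le: "Lip_p F p0 \<le> ereal l0"
    unfolding Lip_p_def using l0 by (intro Inf_lower) auto
  show "Lipusc ?S p0 \<le> Lip_p F p0 / ?t"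
  proof (rule ereal_le_divide_of_less[OF _ _ assms(10)])
    show "0 \<le> Lipusc ?S p0"
      unfolding Lipusc_def by (rule Inf_greatest) auto
    show "\<bar>Lip_p F p0\<bar> \<noteq> \<infinity>"
      using Lip_nonneg Lip_le by auto
    fix c
    assume c: "0 < c" "ereal c < ?t"
    \<comment> \<open>For fixed \<open>c\<close> the bound is put in product form, so that the
      infimum over \<open>l\<close> stands alone on the right; \<open>c\<close> is optimised
      afterwards.\<close>
    have "Lipusc ?S p0 * ereal c \<le> Lip_p F p0"
      unfolding Lip_p_def
    proof (rule Inf_greatest)
      fix a
      assume "a \<in> {ereal l |l. l > 0 \<and> param_lipschitz_const F p0 l}"
      then obtain l where l: "a = ereal l" "l > 0" "param_lipschitz_const F p0 l" by blast
      have "Lipusc ?S p0 \<le> ereal (l / c)"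
        unfolding Lipusc_def using const[OF l(3) c] l(2) c(1) by (intro Inf_lower) auto
      then have "Lipusc ?S p0 * ereal c \<le> ereal (l / c) * ereal c"
        using c(1) by (intro ereal_mult_right_mono) auto
      then show "Lipusc ?S p0 * ereal c \<le> a" using l(1) c(1) by simp
    qed
    then show "Lipusc ?S p0 \<le> Lip_p F p0 / ereal c"
      using c(1) by (simp add: ereal_le_divide_pos mult.commute)
  qed
qed

end
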